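(* Let $n\ge 3$ and $r\ge n-3$ be integers, and let $C_n$ be the cyclic graph on $[n]$. Then the ideal $\mathrm{Inc}(\mathbb{N})_{n,n+r}(I(C_n))\subseteq R_{n+r}$ is Cohen--Macaulay.
   Context: Let $k$ be a field, $R_m=k[x_1,\dots,x_m]$ and $[m]=\{1,\dots,m\}$. For $n\le m$, $\mathrm{Inc}(\mathbb{N})_{n,m}$ is the set of strictly increasing functions $\pi:[n]\to[m]$; each such $\pi$ induces the $k$-algebra homomorphism $\pi:R_n\to R_m$, $x_i\mapsto x_{\pi(i)}$. For an ideal $I\subseteq R_n$, $\mathrm{Inc}(\mathbb{N})_{n,m}(I):=\sum_{\pi\in\mathrm{Inc}(\mathbb{N})_{n,m}}\pi(I)R_m$, the ideal of $R_m$ generated by the images of $I$ under all such $\pi$. The edge ideal of a simple graph $G$ on $[n]$ is $I(G)=(x_ix_j : \{i,j\}\in E(G))\subseteq R_n$. The cyclic graph $C_n$ ($n\ge 3$) on vertex set $[n]$ has edges $\{i,i+1\}$ for $1\le i\le n-1$ together with $\{1,n\}$. An ideal $I\subseteq R_m$ is called Cohen--Macaulay if the (graded) quotient ring $R_m/I$ is Cohen--Macaulay, i.e. $\operatorname{depth}(R_m/I)=\dim(R_m/I)$. *)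

theory Defs
  imports "HOL-Algebra.Algebra" "HOL-Library.Poly_Mapping" "HOL-Library.Extended_Nat"
begin

section \<open>The polynomial rings \<open>R\<^sub>m = k[x\<^sub>1,\<dots>,x\<^sub>m]\<close>\<close>

text \<open>Polynomials in the variables \<open>x\<^sub>0, x\<^sub>1, x\<^sub>2, \<dots>\<close>; a monomial is its exponent vector, and addition
  of exponent vectors makes the multiplication of \<^typ>\<open>'a \<Rightarrow>\<^sub>0 'b\<close> the convolution product. The ring
  \<open>R\<^sub>m\<close> is the subring of the polynomials that involve only \<open>x\<^sub>1, \<dots>, x\<^sub>m\<close> (\<open>x\<^sub>0\<close> never occurs).\<close>

type_synonym 'k mpoly = "(nat \<Rightarrow>\<^sub>0 nat) \<Rightarrow>\<^sub>0 'k"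

definition mconst :: "'k::field \<Rightarrow> 'k mpoly"
  where "mconst c = Poly_Mapping.single 0 c"

definition mvar :: "nat \<Rightarrow> 'k::field mpoly"
  where "mvar i = Poly_Mapping.single (Poly_Mapping.single i 1) 1"

definition poly_ring :: "nat \<Rightarrow> 'k::field mpoly ring"
  where "poly_ring m =
    \<lparr>carrier = {p. \<forall>t\<in>Poly_Mapping.keys p. Poly_Mapping.keys t \<subseteq> {1..m}},
      monoid.mult = (*), one = 1, ring.zero = 0, add = (+)\<rparr>"


section \<open>Increasing maps and the ideals \<open>Inc(\<nat>)\<^sub>n\<^sub>,\<^sub>m(I)\<close>\<close>

definition Inc :: "nat \<Rightarrow> nat \<Rightarrow> (nat \<Rightarrow> nat) set"
  where "Inc n m = {\<pi> \<in> {1..n} \<rightarrow>\<^sub>E {1..m}. strict_mono_on {1..n} \<pi>}"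

text \<open>The \<open>k\<close>-algebra homomorphism \<open>x\<^sub>i \<mapsto> x\<^bsub>\<pi>(i)\<^esub>\<close>, i.e. evaluation of a polynomial at these variables.\<close>

definition var_hom :: "(nat \<Rightarrow> nat) \<Rightarrow> 'k::field mpoly \<Rightarrow> 'k mpoly"
  where "var_hom \<pi> p = 
    (\<Sum>t\<in>Poly_Mapping.keys p. mconst (Poly_Mapping.lookup p t) *
      (\<Prod>i\<in>Poly_Mapping.keys t. mvar (\<pi> i) ^ Poly_Mapping.lookup t i))"

definition Inc_ideal :: "nat \<Rightarrow> nat \<Rightarrow> 'k::field mpoly set \<Rightarrow> 'k mpoly set"
  where "Inc_ideal n m I = genideal (poly_ring m) (\<Union>\<pi>\<in>Inc n m. var_hom \<pi> ` I)"


section \<open>Edge ideals\<close>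

text \<open>A simple graph on \<open>[n]\<close> is given by its set of edges.\<close>

definition simple_graph :: "nat \<Rightarrow> nat set set \<Rightarrow> bool"
  where "simple_graph n E \<longleftrightarrow> (\<forall>e\<in>E. e \<subseteq> {1..n} \<and> card e = 2)"

definition edge_ideal :: "nat \<Rightarrow> nat set set \<Rightarrow> 'k::field mpoly set"
  where "edge_ideal n E = genideal (poly_ring n) {mvar i * mvar j | i j. {i, j} \<in> E}"

definition cycle_edges :: "nat \<Rightarrow> nat set set"
  where "cycle_edges n = {{i, i + 1} | i. 1 \<le> i \<and> i \<le> n - 1} \<union> {{1, n}}"

lemma simple_graph_cycle_edges: "n \<ge> 3 \<Longrightarrow> simple_graph n (cycle_edges n)"
  by (auto simp: simple_graph_def cycle_edges_def)


section \<open>Dimension, depth and Cohen--Macaulayness\<close>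

text \<open>The supremum of the lengths of chains \<open>P\<^sub>0 \<subset> \<dots> \<subset> P\<^sub>d\<close> of prime ideals; the zero ring, which
  has no such chain, gets dimension \<open>0\<close>.\<close>

definition krull_dim :: "('a, 'b) ring_scheme \<Rightarrow> enat"
  where "krull_dim A =
    (SUP Ps \<in> {Ps. Ps \<noteq> [] \<and> (\<forall>P\<in>set Ps. primeideal P A) \<and> sorted_wrt (\<subset>) Ps}. enat (length Ps - 1))"

text \<open>\<open>a\<^sub>1, \<dots>, a\<^sub>d\<close> is regular if each \<open>a\<^sub>i\<close> is a nonzerodivisor on \<open>A/(a\<^sub>1,\<dots>,a\<^bsub>i-1\<^esub>)\<close>, and
  \<open>A/(a\<^sub>1,\<dots>,a\<^sub>d) \<noteq> 0\<close>.\<close>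

definition regular_sequence :: "('a, 'b) ring_scheme \<Rightarrow> 'a list \<Rightarrow> bool"
  where "regular_sequence A as \<longleftrightarrow>
    set as \<subseteq> carrier A \<and>
    (\<forall>i<length as. \<forall>b\<in>carrier A.
       as ! i \<otimes>\<^bsub>A\<^esub> b \<in> genideal A (set (take i as)) \<longrightarrow> b \<in> genideal A (set (take i as))) \<and>
    genideal A (set as) \<noteq> carrier A"

text \<open>The depth (grade) of \<open>A\<close> with respect to the ideal \<open>J\<close>.\<close>

definition depth :: "('a, 'b) ring_scheme \<Rightarrow> 'a set \<Rightarrow> enat"
  where "depth A J = (SUP as \<in> {as. set as \<subseteq> J \<and> regular_sequence A as}. enat (length as))"

definition irrelevant_ideal :: "nat \<Rightarrow> 'k::field mpoly set"
  where "irrelevant_ideal m = genideal (poly_ring m) (mvar ` {1..m})"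

text \<open>For a homogeneous ideal \<open>I\<close>, the depth of the graded ring \<open>R\<^sub>m/I\<close> is the one with respect to
  its homogeneous maximal ideal, the image of \<open>(x\<^sub>1,\<dots>,x\<^sub>m)\<close>.\<close>

definition cohen_macaulay_ideal :: "nat \<Rightarrow> 'k::field mpoly set \<Rightarrow> bool"
  where "cohen_macaulay_ideal m I \<longleftrightarrow>
    ideal I (poly_ring m) \<and>
    depth (poly_ring m Quot I) ((\<lambda>f. I +>\<^bsub>poly_ring m\<^esub> f) ` irrelevant_ideal m)
      = krull_dim (poly_ring m Quot I)"


section \<open>Basic facts\<close>

lemma poly_ring_simps [simp]:
  "carrier (poly_ring m) = {p. \<forall>t\<in>Poly_Mapping.keys p. Poly_Mapping.keys t \<subseteq> {1..m}}"
  "x \<otimes>\<^bsub>poly_ring m\<^esub> y = x * y" "x \<oplus>\<^bsub>poly_ring m\<^esub> y = x + y"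
  "\<one>\<^bsub>poly_ring m\<^esub> = 1" "\<zero>\<^bsub>poly_ring m\<^esub> = 0"
  by (simp_all add: poly_ring_def)

lemma poly_ring_add_closed:
  assumes "p \<in> carrier (poly_ring m)" "q \<in> carrier (poly_ring m)"
  shows "p + q \<in> carrier (poly_ring m)"
proof -
  have "Poly_Mapping.keys (p + q) \<subseteq> Poly_Mapping.keys p \<union> Poly_Mapping.keys q" by (rule keys_add)
  with assms show ?thesis by fastforce
qed

lemma poly_ring_mult_closed:
  assumes "p \<in> carrier (poly_ring m)" "q \<in> carrier (poly_ring m)"
  shows "p * q \<in> carrier (poly_ring m)"
proof -
  have "Poly_Mapping.keys t \<subseteq> {1..m}" if t: "t \<in> Poly_Mapping.keys (p * q)" for t
  proof -
    obtain a b where ab: "t = a + b" "a \<in> Poly_Mapping.keys p" "b \<in> Poly_Mapping.keys q"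
      using subsetD[OF keys_mult t] by auto
    have "Poly_Mapping.keys t \<subseteq> Poly_Mapping.keys a \<union> Poly_Mapping.keys b" unfolding ab(1) by (rule keys_add)
    with ab assms show ?thesis by fastforce
  qed
  then show ?thesis by simp
qed

lemma cring_poly_ring: "cring (poly_ring m :: 'k::field mpoly ring)"
proof (rule cringI)
  show "abelian_group (poly_ring m :: 'k mpoly ring)"
  proof (rule abelian_groupI)
    fix x :: "'k mpoly" assume x: "x \<in> carrier (poly_ring m)"
    have "Poly_Mapping.keys (- x) = Poly_Mapping.keys x" by (auto simp: in_keys_iff)
    with x have "- x \<in> carrier (poly_ring m)" by simp
    then show "\<exists>y\<in>carrier (poly_ring m). y \<oplus>\<^bsub>poly_ring m\<^esub> x = \<zero>\<^bsub>poly_ring m\<^esub>"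
      by (intro bexI[of _ "- x"]) simp_all
  next
    fix x y :: "'k mpoly" assume "x \<in> carrier (poly_ring m)" "y \<in> carrier (poly_ring m)"
    then show "x \<oplus>\<^bsub>poly_ring m\<^esub> y \<in> carrier (poly_ring m)"
      using poly_ring_add_closed by (metis poly_ring_simps(3))
  qed (simp_all add: algebra_simps)
  show "comm_monoid (poly_ring m :: 'k mpoly ring)"
  proof (rule comm_monoidI)
    fix x y :: "'k mpoly" assume "x \<in> carrier (poly_ring m)" "y \<in> carrier (poly_ring m)"
    then show "x \<otimes>\<^bsub>poly_ring m\<^esub> y \<in> carrier (poly_ring m)"
      using poly_ring_mult_closed by (metis poly_ring_simps(2))
  qed (simp_all add: algebra_simps)
qed (simp add: algebra_simps)

abbreviation mon_hom :: "(nat \<Rightarrow> nat) \<Rightarrow> (nat \<Rightarrow>\<^sub>0 nat) \<Rightarrow> 'k::field mpoly"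
  where "mon_hom \<pi> t \<equiv> (\<Prod>i\<in>Poly_Mapping.keys t. mvar (\<pi> i) ^ Poly_Mapping.lookup t i)"

lemma mon_hom_add: "mon_hom \<pi> (s + t) = mon_hom \<pi> s * (mon_hom \<pi> t :: 'k::field mpoly)"
proof -
  let ?K = "Poly_Mapping.keys s \<union> Poly_Mapping.keys t"
  have *: "mon_hom \<pi> u = (\<Prod>i\<in>?K. mvar (\<pi> i) ^ Poly_Mapping.lookup u i :: 'k mpoly)"
    if "Poly_Mapping.keys u \<subseteq> ?K" for u
    using that by (intro prod.mono_neutral_left) (auto simp: in_keys_iff)
  show ?thesis
    unfolding *[OF keys_add] *[OF Un_upper1] *[OF Un_upper2]
    by (simp add: lookup_add power_add prod.distrib)
qed

lemma var_hom_superset: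
  assumes "finite T" "Poly_Mapping.keys p \<subseteq> T"
  shows "var_hom \<pi> p = (\<Sum>t\<in>T. mconst (Poly_Mapping.lookup p t) * mon_hom \<pi> t)"
  unfolding var_hom_def using assms
  by (intro sum.mono_neutral_left) (auto simp: in_keys_iff mconst_def)

lemma var_hom_add: "var_hom \<pi> (p + q) = var_hom \<pi> p + var_hom \<pi> q"
proof -
  let ?T = "Poly_Mapping.keys p \<union> Poly_Mapping.keys q"
  show ?thesis
    by (simp add: var_hom_superset[of ?T] keys_add lookup_add mconst_def single_add
        distrib_right sum.distrib)
qed

lemma var_hom_single: "var_hom \<pi> (Poly_Mapping.single t c) = mconst c * mon_hom \<pi> t"
  using var_hom_superset[of "{t}" "Poly_Mapping.single t c" \<pi>] by simp

lemma var_hom_zero [simp]: "var_hom \<pi> 0 = 0"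
  by (simp add: var_hom_def)

lemma var_hom_const: "var_hom \<pi> (mconst c) = mconst c"
  by (simp add: mconst_def[of c] var_hom_single)

lemma var_hom_var: "var_hom \<pi> (mvar i) = mvar (\<pi> i)"
  by (simp add: mvar_def[of i] var_hom_single) (simp add: mconst_def)

lemma mpoly_sum_singles: "p = (\<Sum>t\<in>Poly_Mapping.keys p. Poly_Mapping.single t (Poly_Mapping.lookup p t))"
  by (rule poly_mapping_eqI)
    (auto simp: lookup_sum lookup_single when_def in_keys_iff sum.delta)

lemma var_hom_sum: "var_hom \<pi> (\<Sum>a\<in>A. f a) = (\<Sum>a\<in>A. var_hom \<pi> (f a))"
  by (induction A rule: infinite_finite_induct) (simp_all add: var_hom_add)

lemma var_hom_mult: "var_hom \<pi> (p * q) = var_hom \<pi> p * var_hom \<pi> q"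
proof -
  have "p * q = (\<Sum>s\<in>Poly_Mapping.keys p. \<Sum>t\<in>Poly_Mapping.keys q.
      Poly_Mapping.single (s + t) (Poly_Mapping.lookup p s * Poly_Mapping.lookup q t))"
    using arg_cong2[OF mpoly_sum_singles[of p] mpoly_sum_singles[of q], of "(*)"]
    unfolding sum_product mult_single .
  then have "var_hom \<pi> (p * q) = (\<Sum>s\<in>Poly_Mapping.keys p. \<Sum>t\<in>Poly_Mapping.keys q.
      mconst (Poly_Mapping.lookup p s * Poly_Mapping.lookup q t) * mon_hom \<pi> (s + t))"
    by (simp only: var_hom_sum var_hom_single)
  also have "\<dots> = (\<Sum>s\<in>Poly_Mapping.keys p. \<Sum>t\<in>Poly_Mapping.keys q.
      (mconst (Poly_Mapping.lookup p s) * mon_hom \<pi> s) *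
      (mconst (Poly_Mapping.lookup q t) * mon_hom \<pi> t))"
  proof (intro sum.cong refl)
    fix s t
    have "mconst (Poly_Mapping.lookup p s * Poly_Mapping.lookup q t) =
      mconst (Poly_Mapping.lookup p s) * mconst (Poly_Mapping.lookup q t)"
      by (simp add: mconst_def mult_single)
    then show "mconst (Poly_Mapping.lookup p s * Poly_Mapping.lookup q t) * mon_hom \<pi> (s + t) =
      (mconst (Poly_Mapping.lookup p s) * mon_hom \<pi> s) *
      (mconst (Poly_Mapping.lookup q t) * mon_hom \<pi> t)"
      by (simp only: mon_hom_add mult_ac)
  qed
  also have "\<dots> = var_hom \<pi> p * var_hom \<pi> q"
    by (simp add: var_hom_def sum_product)
  finally show ?thesis .
qed

end

theory Submission
  imports Defs "HOL-Computational_Algebra.Polynomial"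
begin

text \<open>
  Put \<open>m = n + r\<close>. The edges \<open>{i, i + 1}\<close> of the cycle are moved by increasing maps to all pairs
  \<open>a < b\<close> in \<open>[m]\<close> with \<open>b - a \<le> r + 1\<close>, and the edge \<open>{1, n}\<close> is moved to all pairs with
  \<open>b - a \<ge> n - 1\<close>. The hypothesis \<open>r \<ge> n - 3\<close> says exactly that no difference falls between the
  two ranges. Hence the ideal in question contains every product of two different variables: it is
  the edge ideal of the complete graph, which is the ideal of the union of the \<open>m\<close> coordinate axes
  (\<open>Inc_ideal_cycle\<close>).

  Restricting a polynomial to the axes therefore embeds \<open>A = R\<^sub>m / I\<close> into the product of \<open>m\<close> univariate
  polynomial rings; the image consists of the tuples with a common constant term. Every statement
  about \<open>A\<close> is checked axis by axis through this embedding.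

  The dimension of \<open>A\<close> is one (\<open>krull_dim_axes\<close>). If a prime \<open>P\<close> of \<open>R\<^sub>m\<close> over \<open>I\<close> misses \<open>x\<^sub>i\<close>, then it
  contains every polynomial \<open>p\<close> that vanishes on the \<open>i\<close>-th axis, because \<open>x\<^sub>i p\<close> vanishes on all axes.
  So \<open>P\<close> and all primes above it come from the principal ideal domain \<open>k[x\<^sub>i]\<close>; and if \<open>P\<close> contains
  all variables, it is already maximal.

  The depth of \<open>A\<close> is one (\<open>depth_axes\<close>). The sum of the variables restricts to the coordinate on each
  axis, so it is a nonzerodivisor. Conversely, let \<open>f\<close> be a nonzerodivisor without constant term, and
  let \<open>b\<close> agree with \<open>f\<close> on the first axis and vanish on the others. Then \<open>b\<close> lies outside \<open>(f)\<close> but every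
  element without constant term multiplies it into \<open>(f)\<close>, so no regular sequence in the irrelevant
  ideal has a second member.
\<close>

section \<open>Restriction to a coordinate axis\<close>

definition axis_mon :: "nat \<Rightarrow> (nat \<Rightarrow>\<^sub>0 nat) \<Rightarrow> 'k::field poly"
  where "axis_mon i t =
    (if Poly_Mapping.keys t \<subseteq> {i} then monom 1 (Poly_Mapping.lookup t i) else 0)"

text \<open>Substituting \<open>0\<close> for all variables except \<open>x\<^sub>i\<close>, with the result read as a univariate polynomial.
  It is written as the linear extension of a map on monomials, so that multiplicativity only has to be
  checked on monomials.\<close>

definition axis_res :: "nat \<Rightarrow> 'k::field mpoly \<Rightarrow> 'k poly"
  where "axis_res i p =
    (\<Sum>t\<in>Poly_Mapping.keys p. smult (Poly_Mapping.lookup p t) (axis_mon i t))"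

lemma keys_subset_singleton_iff:
  "Poly_Mapping.keys t \<subseteq> {i} \<and> Poly_Mapping.lookup t i = d \<longleftrightarrow> t = Poly_Mapping.single i d"
  (is "?L \<longleftrightarrow> ?R")
proof
  assume L: ?L
  show ?R
  proof (rule poly_mapping_eqI)
    fix k
    show "Poly_Mapping.lookup t k = Poly_Mapping.lookup (Poly_Mapping.single i d) k"
      using L by (cases "k = i") (auto simp: lookup_single when_def in_keys_iff subset_iff)
  qed
qed auto

lemma coeff_axis_res:
  "coeff (axis_res i p) d = Poly_Mapping.lookup p (Poly_Mapping.single i d)"
proof -
  have "coeff (axis_res i p) d =
      (\<Sum>t\<in>Poly_Mapping.keys p. Poly_Mapping.lookup p t * coeff (axis_mon i t) d)"
    by (simp add: axis_res_def coeff_sum)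
  also have "\<dots> = (\<Sum>t\<in>Poly_Mapping.keys p.
      if t = Poly_Mapping.single i d then Poly_Mapping.lookup p t else 0)"
  proof (rule sum.cong[OF refl])
    fix t :: "nat \<Rightarrow>\<^sub>0 nat"
    show "Poly_Mapping.lookup p t * coeff (axis_mon i t) d =
        (if t = Poly_Mapping.single i d then Poly_Mapping.lookup p t else 0)"
      unfolding keys_subset_singleton_iff[symmetric] axis_mon_def by simp
  qed
  finally show ?thesis
    by (simp add: in_keys_iff)
qed

lemma axis_res_zero [simp]: "axis_res i 0 = 0"
  by (simp add: axis_res_def)

lemma axis_res_add: "axis_res i (p + q) = axis_res i p + axis_res i q"
  by (rule poly_eqI) (simp add: coeff_axis_res lookup_add)

lemma axis_res_diff: "axis_res i (p - q) = axis_res i p - axis_res i q"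
  by (rule poly_eqI) (simp add: coeff_axis_res lookup_minus)

lemma axis_res_sum: "axis_res i (\<Sum>a\<in>A. f a) = (\<Sum>a\<in>A. axis_res i (f a))"
  by (induction A rule: infinite_finite_induct) (simp_all add: axis_res_add)

lemma axis_res_single:
  "axis_res i (Poly_Mapping.single t c) = smult c (axis_mon i t)"
  by (cases "c = 0") (simp_all add: axis_res_def)

lemma axis_mon_add: "axis_mon i (s + t) = axis_mon i s * axis_mon i t"
proof -
  have "Poly_Mapping.keys (s + t) = Poly_Mapping.keys s \<union> Poly_Mapping.keys t"
    by (auto simp: in_keys_iff lookup_add)
  then show ?thesis
    by (simp add: axis_mon_def mult_monom lookup_add)
qed

lemma axis_res_mult: "axis_res i (p * q) = axis_res i p * axis_res i q"
proof -
  have "p * q = (\<Sum>s\<in>Poly_Mapping.keys p. \<Sum>t\<in>Poly_Mapping.keys q.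
      Poly_Mapping.single (s + t) (Poly_Mapping.lookup p s * Poly_Mapping.lookup q t))"
    using arg_cong2[OF mpoly_sum_singles[of p] mpoly_sum_singles[of q], of "(*)"]
    unfolding sum_product mult_single .
  then have "axis_res i (p * q) = (\<Sum>s\<in>Poly_Mapping.keys p. \<Sum>t\<in>Poly_Mapping.keys q.
      smult (Poly_Mapping.lookup p s * Poly_Mapping.lookup q t) (axis_mon i (s + t)))"
    by (simp only: axis_res_sum axis_res_single)
  then show ?thesis
    by (simp add: axis_mon_add axis_res_def sum_product mult.commute)
qed

lemma axis_res_one [simp]: "axis_res i 1 = 1"
  by (simp add: axis_res_single axis_mon_def flip: single_one)

lemma axis_res_mvar: "axis_res i (mvar j) = (if j = i then monom 1 1 else 0)"
  by (simp add: mvar_def axis_res_single axis_mon_def)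

text \<open>All axes meet in the origin: the constant terms of the restrictions of a polynomial agree.
  This is the only relation between the restrictions to different axes.\<close>

lemma coeff_0_axis_res: "coeff (axis_res i p) 0 = Poly_Mapping.lookup p 0"
  by (simp add: coeff_axis_res)

lemma lookup_zero_mult:
  "Poly_Mapping.lookup (p * q) 0 = Poly_Mapping.lookup p 0 * Poly_Mapping.lookup q (0::nat \<Rightarrow>\<^sub>0 nat)"
  for p q :: "'k::field mpoly"
  by (simp add: axis_res_mult coeff_mult_0 flip: coeff_0_axis_res[of 0])

lemma lookup_mvar_zero: "Poly_Mapping.lookup (mvar i) 0 = 0"
  by (simp add: axis_res_mvar flip: coeff_0_axis_res[of i])

text \<open>The substitution of \<open>x\<^sub>i\<close> into a univariate polynomial, a section of the restriction to the
  \<open>i\<close>-th axis. On the other axes it is constant, so for \<open>f\<close> without constant term it prescribes the value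
  \<open>f\<close> on one axis and \<open>0\<close> on the others.\<close>

definition axis_poly :: "nat \<Rightarrow> 'k::field poly \<Rightarrow> 'k mpoly"
  where "axis_poly i f =
    (\<Sum>d\<le>degree f. Poly_Mapping.single (Poly_Mapping.single i d) (coeff f d))"

lemma axis_res_axis_poly_same: "axis_res i (axis_poly i f) = f"
proof -
  have "axis_res i (axis_poly i f) = (\<Sum>d\<le>degree f. monom (coeff f d) d)"
    unfolding axis_poly_def axis_res_sum axis_res_single
    by (rule sum.cong) (auto simp: axis_mon_def smult_monom)
  then show ?thesis
    by (simp add: poly_as_sum_of_monoms)
qed

lemma axis_res_axis_poly_other:
  assumes "j \<noteq> i"
  shows "axis_res j (axis_poly i f) = [:coeff f 0:]"
proof (rule poly_eqI)
  fix d
  have "axis_res j (axis_poly i f) = (\<Sum>d\<le>degree f. if d = 0 then [:coeff f 0:] else 0)"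
    unfolding axis_poly_def axis_res_sum axis_res_single
    using assms by (intro sum.cong) (auto simp: axis_mon_def monom_0)
  then show "coeff (axis_res j (axis_poly i f)) d = coeff [:coeff f 0:] d"
    by simp
qed

section \<open>Ideals of \<open>R\<^sub>m\<close>\<close>

text \<open>Unfolding the carrier would turn each closure fact into a statement about exponent vectors.\<close>

declare poly_ring_simps(1) [simp del]

lemma poly_ring_carrier_iff:
  "p \<in> carrier (poly_ring m) \<longleftrightarrow> (\<forall>t\<in>Poly_Mapping.keys p. Poly_Mapping.keys t \<subseteq> {1..m})"
  by (simp add: poly_ring_simps(1))

lemma zero_carrier [simp]: "0 \<in> carrier (poly_ring m)"
  by (simp add: poly_ring_carrier_iff)

lemma one_carrier [simp]: "1 \<in> carrier (poly_ring m)"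
  by (simp add: poly_ring_carrier_iff)

lemma mvar_carrier: "i \<in> {1..m} \<Longrightarrow> mvar i \<in> carrier (poly_ring m)"
  by (simp add: mvar_def poly_ring_carrier_iff)

lemma single_carrier:
  "Poly_Mapping.keys t \<subseteq> {1..m} \<Longrightarrow> Poly_Mapping.single t c \<in> carrier (poly_ring m)"
  by (simp add: poly_ring_carrier_iff)

lemma poly_ring_uminus_closed:
  "p \<in> carrier (poly_ring m) \<Longrightarrow> - p \<in> carrier (poly_ring m)"
  by (simp add: poly_ring_carrier_iff in_keys_iff)

lemma poly_ring_diff_closed:
  "p \<in> carrier (poly_ring m) \<Longrightarrow> q \<in> carrier (poly_ring m) \<Longrightarrow> p - q \<in> carrier (poly_ring m)"
  using poly_ring_add_closed[of p m "- q"] poly_ring_uminus_closed[of q m] by simp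

lemma poly_ring_sum_closed:
  assumes "\<And>a. a \<in> A \<Longrightarrow> f a \<in> carrier (poly_ring m)"
  shows "(\<Sum>a\<in>A. f a) \<in> carrier (poly_ring m)"
  using assms
proof (induction A rule: infinite_finite_induct)
  case (insert x F)
  then show ?case
    using poly_ring_add_closed[of "f x" m "sum f F"] by simp
qed simp_all

lemma axis_poly_carrier:
  assumes "i \<in> {1..m}"
  shows "axis_poly i f \<in> carrier (poly_ring m)"
  unfolding axis_poly_def using assms by (intro poly_ring_sum_closed single_carrier) simp

lemma a_inv_poly_ring:
  fixes p :: "'k::field mpoly"
  assumes "p \<in> carrier (poly_ring m)"
  shows "\<ominus>\<^bsub>poly_ring m\<^esub> p = - p"
proof -
  interpret cring "poly_ring m :: 'k mpoly ring" by (rule cring_poly_ring)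
  have "- p \<oplus>\<^bsub>poly_ring m\<^esub> p = \<zero>\<^bsub>poly_ring m\<^esub>" by simp
  then show ?thesis
    using assms poly_ring_uminus_closed[OF assms] by (rule minus_equality)
qed

lemma a_minus_poly_ring:
  assumes "p \<in> carrier (poly_ring m)" "q \<in> carrier (poly_ring m)"
  shows "p \<ominus>\<^bsub>poly_ring m\<^esub> q = p - q"
  by (simp add: a_minus_def a_inv_poly_ring[OF assms(2)])

lemma poly_ring_idealI:
  fixes J :: "'k::field mpoly set"
  assumes sub: "J \<subseteq> carrier (poly_ring m)" and zero_mem: "0 \<in> J"
    and add: "\<And>p q. p \<in> J \<Longrightarrow> q \<in> J \<Longrightarrow> p + q \<in> J"
    and mult: "\<And>p q. p \<in> J \<Longrightarrow> q \<in> carrier (poly_ring m) \<Longrightarrow> q * p \<in> J"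
  shows "ideal J (poly_ring m)"
proof -
  interpret cring "poly_ring m :: 'k mpoly ring" by (rule cring_poly_ring)
  show ?thesis
  proof (rule idealI)
    show "ring (poly_ring m :: 'k mpoly ring)" by (rule ring_axioms)
    show "subgroup J (add_monoid (poly_ring m))"
    proof (rule add.subgroupI)
      fix p assume p: "p \<in> J"
      have "- 1 \<in> carrier (poly_ring m :: 'k mpoly ring)"
        using poly_ring_uminus_closed[of 1 m] by simp
      with mult[OF p this] sub p show "\<ominus>\<^bsub>poly_ring m\<^esub> p \<in> J"
        by (simp add: a_inv_poly_ring subset_iff)
    qed (use sub zero_mem add in auto)
    show "a \<otimes>\<^bsub>poly_ring m\<^esub> x \<in> J" "x \<otimes>\<^bsub>poly_ring m\<^esub> a \<in> J"
      if "a \<in> J" "x \<in> carrier (poly_ring m)" for a x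
      using mult[OF that] by (simp_all add: mult.commute)
  qed
qed

lemma poly_ring_ideal_closed:
  fixes J :: "'k::field mpoly set"
  assumes "ideal J (poly_ring m)"
  shows "0 \<in> J" "p \<in> J \<Longrightarrow> q \<in> J \<Longrightarrow> p + q \<in> J" "p \<in> J \<Longrightarrow> q \<in> J \<Longrightarrow> p - q \<in> J"
    "p \<in> J \<Longrightarrow> q \<in> carrier (poly_ring m) \<Longrightarrow> q * p \<in> J"
    "p \<in> J \<Longrightarrow> p \<in> carrier (poly_ring m)"
proof -
  interpret ideal J "poly_ring m" by (rule assms)
  show carr: "p \<in> J \<Longrightarrow> p \<in> carrier (poly_ring m)" for p by (rule a_Hcarr)
  show "0 \<in> J" using additive_subgroup.zero_closed[OF ideal.axioms(1)[OF assms]] by simp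
  show add: "p \<in> J \<Longrightarrow> q \<in> J \<Longrightarrow> p + q \<in> J" for p q using additive_subgroup.a_closed[OF ideal.axioms(1)[OF assms], of p q] by simp
  show mult: "p \<in> J \<Longrightarrow> q \<in> carrier (poly_ring m) \<Longrightarrow> q * p \<in> J" for p q
    using I_l_closed[of p q] by simp
  show "p - q \<in> J" if "p \<in> J" "q \<in> J"
    using add[OF that(1) mult[OF that(2) poly_ring_uminus_closed[OF one_carrier]]] by simp
qed

lemma poly_ring_ideal_terms:
  assumes J: "ideal J (poly_ring m)"
    and terms: "\<And>t. t \<in> Poly_Mapping.keys p \<Longrightarrow> Poly_Mapping.single t (Poly_Mapping.lookup p t) \<in> J"
  shows "p \<in> J"
proof -
  have "(\<Sum>t\<in>T. Poly_Mapping.single t (Poly_Mapping.lookup p t)) \<in> J"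
    if "finite T" "T \<subseteq> Poly_Mapping.keys p" for T
    using that
  proof (induction T rule: finite_induct)
    case (insert t T)
    then show ?case
      using poly_ring_ideal_closed(2)[OF J] terms by simp
  qed (simp add: poly_ring_ideal_closed(1)[OF J])
  from this[OF finite_keys subset_refl] show ?thesis
    using mpoly_sum_singles[of p] by simp
qed

text \<open>An ideal that contains a monomial contains all multiples of that monomial; together with
  \<open>poly_ring_ideal_terms\<close> this decides membership in monomial ideals term by term.\<close>

lemma single_in_ideal_of_divisor:
  assumes J: "ideal J (poly_ring m)" and u: "Poly_Mapping.single u 1 \<in> J"
    and t: "Poly_Mapping.keys t \<subseteq> {1..m}"
    and le: "\<And>i. Poly_Mapping.lookup u i \<le> Poly_Mapping.lookup t i"
  shows "Poly_Mapping.single t c \<in> J"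
proof -
  have t': "t = (t - u) + u"
    by (rule poly_mapping_eqI) (simp add: lookup_add lookup_minus le)
  have "Poly_Mapping.keys (t - u) \<subseteq> Poly_Mapping.keys t"
    by (auto simp: in_keys_iff lookup_minus)
  with t have "Poly_Mapping.single (t - u) c \<in> carrier (poly_ring m)"
    by (intro single_carrier) blast
  from poly_ring_ideal_closed(4)[OF J u this]
  show ?thesis
    by (simp add: mult_single flip: t')
qed

lemma irrelevant_ideal_eq:
  "irrelevant_ideal m = {p \<in> carrier (poly_ring m). Poly_Mapping.lookup p 0 = (0::'k::field)}"
  (is "_ = ?M")
proof
  interpret cring "poly_ring m :: 'k mpoly ring" by (rule cring_poly_ring)
  have vars: "mvar ` {1..m} \<subseteq> carrier (poly_ring m :: 'k mpoly ring)"
    using mvar_carrier by blast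
  have "ideal ?M (poly_ring m)"
    using poly_ring_add_closed poly_ring_mult_closed
    by (intro poly_ring_idealI) (auto simp: lookup_zero_mult lookup_add)
  then show "irrelevant_ideal m \<subseteq> ?M"
    unfolding irrelevant_ideal_def
    by (rule genideal_minimal) (auto simp: lookup_mvar_zero mvar_carrier)
  have J: "ideal (irrelevant_ideal m :: 'k mpoly set) (poly_ring m)"
    unfolding irrelevant_ideal_def by (rule genideal_ideal[OF vars])
  have gen: "mvar i \<in> (irrelevant_ideal m :: 'k mpoly set)" if "i \<in> {1..m}" for i
    unfolding irrelevant_ideal_def using genideal_self[OF vars] that by blast
  show "?M \<subseteq> irrelevant_ideal m"
  proof
    fix p :: "'k mpoly" assume p: "p \<in> ?M"
    show "p \<in> irrelevant_ideal m"
    proof (rule poly_ring_ideal_terms[OF J])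
      fix t assume t: "t \<in> Poly_Mapping.keys p"
      with p have "t \<noteq> 0" and tm: "Poly_Mapping.keys t \<subseteq> {1..m}"
        by (auto simp: in_keys_iff poly_ring_carrier_iff)
      then obtain a where a: "a \<in> Poly_Mapping.keys t"
        by (metis all_not_in_conv keys_eq_empty)
      show "Poly_Mapping.single t (Poly_Mapping.lookup p t) \<in> irrelevant_ideal m"
      proof (rule single_in_ideal_of_divisor[OF J _ tm])
        show "Poly_Mapping.single (Poly_Mapping.single a 1) 1 \<in> (irrelevant_ideal m :: 'k mpoly set)"
          using gen[OF subsetD[OF tm a]] by (simp add: mvar_def)
        show "Poly_Mapping.lookup (Poly_Mapping.single a 1) i \<le> Poly_Mapping.lookup t i" for i
          using a by (auto simp: lookup_single when_def in_keys_iff)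
      qed
    qed
  qed
qed

section \<open>The ideal of the union of the coordinate axes\<close>

definition axes_ideal :: "nat \<Rightarrow> 'k::field mpoly set"
  where "axes_ideal m = {p \<in> carrier (poly_ring m). \<forall>i\<in>{1..m}. axis_res i p = 0}"

lemma ideal_axes_ideal: "ideal (axes_ideal m) (poly_ring m)"
  using poly_ring_add_closed poly_ring_mult_closed
  by (intro poly_ring_idealI) (auto simp: axes_ideal_def axis_res_add axis_res_mult)

text \<open>A polynomial vanishes on all axes only if none of its monomials is a constant or a power of a
  single variable, so each monomial is divisible by a product of two different variables. The
  assumption \<open>m \<ge> 1\<close> matters for the constants: without an axis they vanish vacuously.\<close>

lemma axes_ideal_subset:
  fixes J :: "'k::field mpoly set"
  assumes J: "ideal J (poly_ring m)" and "m \<ge> 1"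
    and edges: "\<And>a b. 1 \<le> a \<Longrightarrow> a < b \<Longrightarrow> b \<le> m \<Longrightarrow> mvar a * mvar b \<in> J"
  shows "axes_ideal m \<subseteq> J"
proof
  fix p :: "'k mpoly" assume p: "p \<in> axes_ideal m"
  show "p \<in> J"
  proof (rule poly_ring_ideal_terms[OF J])
    fix t assume t: "t \<in> Poly_Mapping.keys p"
    with p have tm: "Poly_Mapping.keys t \<subseteq> {1..m}"
      by (auto simp: axes_ideal_def poly_ring_carrier_iff)
    have not_pure: "\<not> Poly_Mapping.keys t \<subseteq> {i}" if "i \<in> {1..m}" for i
    proof
      assume "Poly_Mapping.keys t \<subseteq> {i}"
      then have "t = Poly_Mapping.single i (Poly_Mapping.lookup t i)"
        using keys_subset_singleton_iff[of t i "Poly_Mapping.lookup t i"] by blast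
      then have "Poly_Mapping.lookup p t = coeff (axis_res i p) (Poly_Mapping.lookup t i)"
        by (simp add: coeff_axis_res)
      also have "\<dots> = 0"
        using p that by (simp add: axes_ideal_def)
      finally show False
        using t by (simp add: in_keys_iff)
    qed
    obtain a where a: "a \<in> Poly_Mapping.keys t"
      using not_pure[of 1] \<open>m \<ge> 1\<close> by auto
    obtain b where b: "b \<in> Poly_Mapping.keys t" "b \<noteq> a"
      using not_pure[OF subsetD[OF tm a]] by blast
    define u where "u = Poly_Mapping.single (min a b) (1::nat) + Poly_Mapping.single (max a b) 1"
    show "Poly_Mapping.single t (Poly_Mapping.lookup p t) \<in> J"
    proof (rule single_in_ideal_of_divisor[OF J _ tm])
      have "mvar (min a b) * mvar (max a b) \<in> J"
        using a b tm by (intro edges) auto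
      then show "Poly_Mapping.single u 1 \<in> J"
        by (simp add: mvar_def mult_single u_def)
      show "Poly_Mapping.lookup u i \<le> Poly_Mapping.lookup t i" for i
        using a b by (auto simp: u_def lookup_add lookup_single when_def in_keys_iff min_def max_def)
    qed
  qed
qed

section \<open>The orbit of the cycle is the complete graph\<close>

text \<open>If \<open>b - a \<ge> n - 1\<close>, there is room to place the \<open>n - 2\<close> inner vertices between \<open>a\<close> and \<open>b\<close>, so the
  edge \<open>{1, n}\<close> can be stretched to \<open>{a, b}\<close>. Otherwise \<open>b - a \<le> n - 2 \<le> r + 1\<close>, and some \<open>{i, i + 1}\<close>
  works: the first \<open>i\<close> vertices are placed immediately up to \<open>a\<close> and the others immediately from
  \<open>b\<close> on.\<close>

lemma cycle_orbit_complete: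
  assumes "n \<ge> 3" "r \<ge> n - 3" "1 \<le> a" "a < b" "b \<le> n + r"
  obtains \<pi> i j where "\<pi> \<in> Inc n (n + r)" "{i, j} \<in> cycle_edges n" "\<pi> i = a" "\<pi> j = b"
proof (cases "b - a \<ge> n - 1")
  case True
  define \<pi> where "\<pi> = restrict (\<lambda>k. if k = n then b else a + k - 1) {1..n}"
  have "\<pi> \<in> Inc n (n + r)"
    unfolding Inc_def \<pi>_def strict_mono_on_def using assms True by auto
  moreover have "{1, n} \<in> cycle_edges n"
    by (simp add: cycle_edges_def)
  moreover have "\<pi> 1 = a" "\<pi> n = b"
    using assms by (auto simp: \<pi>_def)
  ultimately show thesis by (rule that)
next
  case False
  \<comment> \<open>There must be \<open>i \<le> a\<close> places up to \<open>a\<close> and \<open>n - i \<le> n + r - b + 1\<close> places from \<open>b\<close> on. The second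
      condition asks for a large \<open>i\<close>, so the largest \<open>i\<close> that the first one permits is taken.\<close>
  define i where "i = min a (n - 1)"
  define \<pi> where "\<pi> = restrict (\<lambda>k. if k \<le> i then a + k - i else b + k - (i + 1)) {1..n}"
  have i: "1 \<le> i" "i \<le> n - 1" "i \<le> a" "b + n \<le> n + r + i + 1"
    using assms False by (auto simp: i_def)
  have "\<pi> \<in> Inc n (n + r)"
    unfolding Inc_def \<pi>_def strict_mono_on_def using assms i by auto
  moreover have "{i, i + 1} \<in> cycle_edges n"
    using i by (auto simp: cycle_edges_def)
  moreover have "\<pi> i = a" "\<pi> (i + 1) = b"
    using assms i by (auto simp: \<pi>_def)
  ultimately show thesis by (rule that)
qed

lemma var_hom_carrier:
  assumes \<pi>: "\<pi> \<in> {1..n} \<rightarrow> {1..m}" and p: "p \<in> carrier (poly_ring n)"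
  shows "var_hom \<pi> p \<in> carrier (poly_ring m :: 'k::field mpoly ring)"
proof -
  have power: "mvar i ^ d \<in> carrier (poly_ring m :: 'k mpoly ring)" if "i \<in> {1..m}" for i d
  proof (induction d)
    case (Suc d)
    then show ?case
      using poly_ring_mult_closed[OF mvar_carrier[OF that]] by simp
  qed simp
  have prod: "(\<Prod>i\<in>K. mvar (\<pi> i) ^ d i) \<in> carrier (poly_ring m :: 'k mpoly ring)"
    if "finite K" "K \<subseteq> {1..n}" for K :: "nat set" and d
    using that
  proof (induction K rule: finite_induct)
    case (insert i K)
    then have "mvar (\<pi> i) ^ d i \<in> carrier (poly_ring m :: 'k mpoly ring)"
      using \<pi> by (intro power) auto
    with insert show ?case
      using poly_ring_mult_closed by simp
  qed simp
  show ?thesis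
    unfolding var_hom_def
  proof (intro poly_ring_sum_closed poly_ring_mult_closed prod finite_keys)
    show "mconst c \<in> carrier (poly_ring m :: 'k mpoly ring)" for c
      unfolding mconst_def by (rule single_carrier) simp
    show "Poly_Mapping.keys t \<subseteq> {1..n}" if "t \<in> Poly_Mapping.keys p" for t
      using p that by (auto simp: poly_ring_carrier_iff)
  qed
qed

text \<open>An increasing map is injective, so it sends the product of the ends of an edge to a product of
  two different variables. Such a product vanishes on every axis.\<close>

lemma var_hom_edge_ideal_subset:
  assumes \<pi>: "\<pi> \<in> Inc n m" and E: "simple_graph n E"
  shows "var_hom \<pi> ` edge_ideal n E \<subseteq> (axes_ideal m :: 'k::field mpoly set)"
proof -
  interpret cring "poly_ring n :: 'k mpoly ring" by (rule cring_poly_ring)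
  let ?V = "{p \<in> carrier (poly_ring n). var_hom \<pi> p \<in> (axes_ideal m :: 'k mpoly set)}"
  have \<pi>_fun: "\<pi> \<in> {1..n} \<rightarrow> {1..m}" and \<pi>_mono: "strict_mono_on {1..n} \<pi>"
    using \<pi> by (auto simp: Inc_def)
  note closed = poly_ring_ideal_closed[OF ideal_axes_ideal[of m, where ?'a = 'k]]
  have "ideal ?V (poly_ring n)"
    using poly_ring_add_closed[of _ n] poly_ring_mult_closed[of _ n] closed
      var_hom_carrier[OF \<pi>_fun, where ?'k = 'k]
    by (intro poly_ring_idealI) (auto simp: var_hom_add var_hom_mult)
  moreover have "mvar i * mvar j \<in> ?V" if "{i, j} \<in> E" for i j
  proof -
    have "{i, j} \<subseteq> {1..n}" "card {i, j} = 2"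
      using E that by (auto simp: simple_graph_def)
    then have ij: "i \<in> {1..n}" "j \<in> {1..n}" "i \<noteq> j"
      by auto
    then have "\<pi> i \<noteq> \<pi> j"
      using strict_mono_on_imp_inj_on[OF \<pi>_mono] by (auto dest: inj_onD)
    moreover have "\<pi> i \<in> {1..m}" "\<pi> j \<in> {1..m}"
      using \<pi>_fun ij by auto
    ultimately show ?thesis
      using ij poly_ring_mult_closed[OF mvar_carrier mvar_carrier]
      by (auto simp: var_hom_mult var_hom_var axes_ideal_def axis_res_mult axis_res_mvar)
  qed
  ultimately have "edge_ideal n E \<subseteq> ?V"
    unfolding edge_ideal_def by (intro genideal_minimal) auto
  then show ?thesis by auto
qed

lemma Inc_ideal_cycle:
  assumes "n \<ge> 3" "r \<ge> n - 3"
  shows "Inc_ideal n (n + r) (edge_ideal n (cycle_edges n)) =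
    (axes_ideal (n + r) :: 'k::field mpoly set)"
proof
  let ?E = "edge_ideal n (cycle_edges n) :: 'k mpoly set"
  let ?S = "\<Union>\<pi>\<in>Inc n (n + r). var_hom \<pi> ` ?E"
  interpret R: cring "poly_ring (n + r) :: 'k mpoly ring" by (rule cring_poly_ring)
  interpret Rn: cring "poly_ring n :: 'k mpoly ring" by (rule cring_poly_ring)
  have graph: "simple_graph n (cycle_edges n)"
    using assms by (intro simple_graph_cycle_edges)
  have S: "?S \<subseteq> axes_ideal (n + r)"
    using var_hom_edge_ideal_subset[OF _ graph] by blast
  then show "Inc_ideal n (n + r) ?E \<subseteq> axes_ideal (n + r)"
    unfolding Inc_ideal_def by (intro R.genideal_minimal ideal_axes_ideal)
  have S_carrier: "?S \<subseteq> carrier (poly_ring (n + r))"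
    using S by (auto simp: axes_ideal_def)
  show "axes_ideal (n + r) \<subseteq> Inc_ideal n (n + r) ?E"
  proof (rule axes_ideal_subset)
    show "ideal (Inc_ideal n (n + r) ?E) (poly_ring (n + r))"
      unfolding Inc_ideal_def by (rule R.genideal_ideal[OF S_carrier])
    show "n + r \<ge> 1"
      using assms by simp
    fix a b :: nat assume "1 \<le> a" "a < b" "b \<le> n + r"
    then obtain \<pi> i j where \<pi>: "\<pi> \<in> Inc n (n + r)" and ij: "{i, j} \<in> cycle_edges n"
      and ab: "\<pi> i = a" "\<pi> j = b"
      using cycle_orbit_complete[OF assms] by blast
    have "mvar i * mvar j \<in> carrier (poly_ring n :: 'k mpoly ring)" if "{i, j} \<in> cycle_edges n" for i j
      using graph that by (intro poly_ring_mult_closed mvar_carrier) (auto simp: simple_graph_def)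
    then have "mvar i * mvar j \<in> ?E"
      unfolding edge_ideal_def using ij by (intro subsetD[OF Rn.genideal_self]) auto
    moreover have "var_hom \<pi> (mvar i * mvar j) = (mvar a * mvar b :: 'k mpoly)"
      by (simp add: var_hom_mult var_hom_var ab)
    ultimately have "mvar a * mvar b \<in> ?S"
      using \<pi> by (metis (no_types, lifting) UN_I image_eqI)
    then show "mvar a * mvar b \<in> Inc_ideal n (n + r) ?E"
      unfolding Inc_ideal_def using R.genideal_self[OF S_carrier] by blast
  qed
qed

section \<open>Chains of primes in a quotient ring\<close>

lemma (in cring) coset_mem_image_iff:
  assumes I: "ideal I R" and P: "ideal P R" "I \<subseteq> P" and a: "a \<in> carrier R"
  shows "I +> a \<in> (+>) I ` P \<longleftrightarrow> a \<in> P"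
proof
  assume "I +> a \<in> (+>) I ` P"
  then obtain p where p: "p \<in> P" and eq: "I +> a = I +> p"
    by blast
  have pR: "p \<in> carrier R"
    using p P(1) by (rule ideal.Icarr[rotated])
  have "a \<ominus> p \<in> P"
    using quotient_eq_iff_same_a_r_cos[OF I a pR] eq P(2) by blast
  then have "(a \<ominus> p) \<oplus> p \<in> P"
    using additive_subgroup.a_closed[OF ideal.axioms(1)[OF P(1)]] p by blast
  then show "a \<in> P"
    using a pR by (simp add: minus_eq a_assoc l_neg)
qed blast

lemma (in cring) primeideal_image_quotient:
  assumes I: "ideal I R" and P: "primeideal P R" and sub: "I \<subseteq> P"
  shows "primeideal ((+>) I ` P) (R Quot I)"
proof -
  interpret P: primeideal P R by (rule P)
  note mem = coset_mem_image_iff[OF I P.is_ideal sub]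
  show ?thesis
  proof (rule primeidealI)
    show "ideal ((+>) I ` P) (R Quot I)"
      by (rule ring_ideal_imp_quot_ideal[OF I P.is_ideal])
    show "cring (R Quot I)"
      by (rule ideal.quotient_is_cring[OF I cring_axioms])
    show "carrier (R Quot I) \<noteq> (+>) I ` P"
    proof
      assume "carrier (R Quot I) = (+>) I ` P"
      then have "I +> \<one> \<in> (+>) I ` P"
        by (auto simp: FactRing_def A_RCOSETS_def')
      then show False
        using mem[of \<one>] P.one_imp_carrier P.I_notcarr by auto
    qed
    fix x y assume "x \<in> carrier (R Quot I)" "y \<in> carrier (R Quot I)"
    then obtain a b where a: "a \<in> carrier R" "x = I +> a" and b: "b \<in> carrier R" "y = I +> b"
      by (auto simp: FactRing_def A_RCOSETS_def')
    assume "x \<otimes>\<^bsub>R Quot I\<^esub> y \<in> (+>) I ` P"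
    then have "a \<otimes> b \<in> P"
      using mem[of "a \<otimes> b"] a b by (simp add: FactRing_def ideal.rcoset_mult_add[OF I])
    then show "x \<in> (+>) I ` P \<or> y \<in> (+>) I ` P"
      using P.I_prime a b by blast
  qed
qed

text \<open>Taking preimages and images under the projection preserves primality and strict inclusions,
  so chains of primes of \<open>R / I\<close> and chains of primes of \<open>R\<close> over \<open>I\<close> have the same lengths.\<close>

lemma (in cring) krull_dim_quotient:
  assumes I: "ideal I R"
  shows "krull_dim (R Quot I) =
    (SUP Ps \<in> {Ps. Ps \<noteq> [] \<and> (\<forall>P\<in>set Ps. primeideal P R \<and> I \<subseteq> P) \<and> sorted_wrt (\<subset>) Ps}.
      enat (length Ps - 1))"
    (is "_ = (SUP Ps \<in> ?C. _)")
  unfolding krull_dim_def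
proof (rule SUP_eq)
  let ?pre = "\<lambda>Q. {a \<in> carrier R. I +> a \<in> Q}"
  fix Qs assume "Qs \<in> {Qs. Qs \<noteq> [] \<and> (\<forall>Q\<in>set Qs. primeideal Q (R Quot I)) \<and> sorted_wrt (\<subset>) Qs}"
  then have Qs: "Qs \<noteq> []" "\<And>Q. Q \<in> set Qs \<Longrightarrow> primeideal Q (R Quot I)" "sorted_wrt (\<subset>) Qs"
    by auto
  have prime: "primeideal (?pre Q) R \<and> I \<subseteq> ?pre Q" if "Q \<in> set Qs" for Q
  proof
    show "primeideal (?pre Q) R"
      using ring_hom_ring.primeideal_vimage[OF ideal.rcos_ring_hom_ring[OF I] cring_axioms Qs(2)[OF that]] .
    have "\<zero>\<^bsub>R Quot I\<^esub> \<in> Q"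
      using Qs(2)[OF that] by (intro additive_subgroup.zero_closed ideal.axioms(1) primeideal.axioms(1))
    moreover have "I +> a = \<zero>\<^bsub>R Quot I\<^esub>" if "a \<in> I" for a
      using that I by (simp add: FactRing_def ideal.Icarr[OF I] a_coset_join2 additive_subgroup.a_subgroup ideal.axioms(1))
    ultimately show "I \<subseteq> ?pre Q"
      using ideal.Icarr[OF I] by auto
  qed
  have strict: "?pre Q \<subset> ?pre Q'" if Q: "Q' \<in> set Qs" "Q \<subset> Q'" for Q Q'
  proof -
    from Q(2) obtain x where x: "x \<in> Q'" "x \<notin> Q" by auto
    have "x \<in> carrier (R Quot I)"
      using ideal.Icarr[OF primeideal.axioms(1)[OF Qs(2)[OF Q(1)]] x(1)] .
    then obtain a where "a \<in> carrier R" "x = I +> a"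
      by (auto simp: FactRing_def A_RCOSETS_def')
    with x Q(2) show ?thesis by auto
  qed
  have "sorted_wrt (\<subset>) (map ?pre Qs)"
    unfolding sorted_wrt_map by (rule sorted_wrt_mono_rel[OF _ Qs(3)]) (rule strict)
  then show "\<exists>Ps\<in>?C. enat (length Qs - 1) \<le> enat (length Ps - 1)"
    using Qs(1) prime by (intro bexI[of _ "map ?pre Qs"]) auto
next
  fix Ps assume "Ps \<in> ?C"
  then have Ps: "Ps \<noteq> []" "\<And>P. P \<in> set Ps \<Longrightarrow> primeideal P R" "\<And>P. P \<in> set Ps \<Longrightarrow> I \<subseteq> P"
      "sorted_wrt (\<subset>) Ps"
    by auto
  have strict: "(+>) I ` P \<subset> (+>) I ` P'" if P: "P \<in> set Ps" "P' \<in> set Ps" "P \<subset> P'" for P P'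
  proof -
    from P(3) obtain a where a: "a \<in> P'" "a \<notin> P" by auto
    have "a \<in> carrier R"
      using ideal.Icarr[OF primeideal.axioms(1)[OF Ps(2)[OF P(2)]] a(1)] .
    then have "I +> a \<notin> (+>) I ` P"
      using coset_mem_image_iff[OF I primeideal.axioms(1)[OF Ps(2)[OF P(1)]] Ps(3)[OF P(1)]] a(2) by blast
    with a(1) P(3) show ?thesis by blast
  qed
  have "sorted_wrt (\<subset>) (map ((`) ((+>) I)) Ps)"
    unfolding sorted_wrt_map by (rule sorted_wrt_mono_rel[OF _ Ps(4)]) (rule strict)
  then show "\<exists>Qs\<in>{Qs. Qs \<noteq> [] \<and> (\<forall>Q\<in>set Qs. primeideal Q (R Quot I)) \<and> sorted_wrt (\<subset>) Qs}.
      enat (length Ps - 1) \<le> enat (length Qs - 1)"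
    using Ps(1) primeideal_image_quotient[OF I Ps(2) Ps(3)]
    by (intro bexI[of _ "map ((`) ((+>) I)) Ps"]) auto
qed

section \<open>The union of the axes has dimension one\<close>

text \<open>A nonzero element of least degree generates, by division with remainder.\<close>

lemma poly_ideal_principal:
  fixes Q :: "'k::field poly set"
  assumes diff: "\<And>f g. f \<in> Q \<Longrightarrow> g \<in> Q \<Longrightarrow> f - g \<in> Q"
    and mult: "\<And>f g. f \<in> Q \<Longrightarrow> g * f \<in> Q"
    and "Q \<noteq> {}"
  shows "\<exists>h\<in>Q. \<forall>f\<in>Q. h dvd f"
proof (cases "Q = {0}")
  case False
  with \<open>Q \<noteq> {}\<close> obtain f\<^sub>0 where f\<^sub>0: "f\<^sub>0 \<in> Q \<and> f\<^sub>0 \<noteq> 0" by auto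
  define h where "h = (ARG_MIN degree f. f \<in> Q \<and> f \<noteq> 0)"
  have h: "h \<in> Q" "h \<noteq> 0"
    using arg_min_natI[of "\<lambda>f. f \<in> Q \<and> f \<noteq> 0" f\<^sub>0 degree, OF f\<^sub>0] by (auto simp: h_def)
  have min: "degree h \<le> degree f" if "f \<in> Q" "f \<noteq> 0" for f
    unfolding h_def using that by (intro arg_min_nat_le) auto
  have "h dvd f" if f: "f \<in> Q" for f
  proof -
    have "f mod h = f - (f div h) * h"
      by (simp add: minus_div_mult_eq_mod)
    then have "f mod h \<in> Q"
      using diff[OF f mult[OF h(1)]] by simp
    then have "f mod h = 0"
      using min[of "f mod h"] degree_mod_less[OF h(2), of f] by fastforce
    then show ?thesis by (simp add: mod_eq_0_iff_dvd)
  qed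
  with h(1) show ?thesis by blast
qed simp

text \<open>Let \<open>p\<close> and \<open>q\<close> generate \<open>P\<close> and \<open>Q\<close>, so that \<open>p = q u\<close> with \<open>q \<in> P\<close> or \<open>u \<in> P\<close>. In the first case
  \<open>P = Q\<close>; in the second \<open>p\<close> divides \<open>u\<close>, so \<open>q\<close> is a unit.\<close>

lemma poly_nonzero_prime_maximal:
  fixes P Q :: "'k::field poly set"
  assumes P: "\<And>f g. f \<in> P \<Longrightarrow> g \<in> P \<Longrightarrow> f - g \<in> P" "\<And>f g. f \<in> P \<Longrightarrow> g * f \<in> P"
    and prime: "\<And>f g. f * g \<in> P \<Longrightarrow> f \<in> P \<or> g \<in> P"
    and Q: "\<And>f g. f \<in> Q \<Longrightarrow> g \<in> Q \<Longrightarrow> f - g \<in> Q" "\<And>f g. f \<in> Q \<Longrightarrow> g * f \<in> Q"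
    and nonzero: "f\<^sub>0 \<in> P" "f\<^sub>0 \<noteq> 0" and sub: "P \<subseteq> Q" and proper: "1 \<notin> Q"
  shows "P = Q"
proof -
  have "P \<noteq> {}" "Q \<noteq> {}"
    using nonzero(1) sub by auto
  have "\<exists>p\<in>P. \<forall>f\<in>P. p dvd f"
    by (rule poly_ideal_principal[OF P \<open>P \<noteq> {}\<close>])
  then obtain p where p: "\<And>f. f \<in> P \<Longrightarrow> p dvd f" "p \<in> P" by blast
  have "\<exists>q\<in>Q. \<forall>f\<in>Q. q dvd f"
    by (rule poly_ideal_principal[OF Q \<open>Q \<noteq> {}\<close>])
  then obtain q where q: "\<And>f. f \<in> Q \<Longrightarrow> q dvd f" "q \<in> Q" by blast
  have "p \<noteq> 0"
    using p(1)[OF nonzero(1)] nonzero(2) by auto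
  obtain u where u: "p = q * u"
    using q(1) p(2) sub by (auto elim: dvdE)
  have "u \<notin> P"
  proof
    assume "u \<in> P"
    then obtain v where "u = p * v"
      using p(1) by (auto elim: dvdE)
    with u \<open>p \<noteq> 0\<close> have "v * q = 1"
      by (simp add: algebra_simps)
    with Q(2)[OF q(2), of v] proper show False by simp
  qed
  with prime[of q u] p(2) u have "q \<in> P" by auto
  have "f \<in> P" if "f \<in> Q" for f
    using q(1)[OF that] P(2)[OF \<open>q \<in> P\<close>] by (metis dvdE mult.commute)
  with sub show ?thesis by blast
qed

lemma primeideal_poly_ringD:
  fixes P :: "'k::field mpoly set"
  assumes "primeideal P (poly_ring m)"
  shows "ideal P (poly_ring m)" "1 \<notin> P"
    "p \<in> carrier (poly_ring m) \<Longrightarrow> q \<in> carrier (poly_ring m) \<Longrightarrow> p * q \<in> P \<Longrightarrow> p \<in> P \<or> q \<in> P"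
proof -
  interpret primeideal P "poly_ring m" by (rule assms)
  show "ideal P (poly_ring m)" by (rule is_ideal)
  show "1 \<notin> P" using one_imp_carrier I_notcarr by auto
  show "p \<in> carrier (poly_ring m) \<Longrightarrow> q \<in> carrier (poly_ring m) \<Longrightarrow> p * q \<in> P \<Longrightarrow> p \<in> P \<or> q \<in> P"
    using I_prime[of p q] by simp
qed

text \<open>Modulo the irrelevant ideal every polynomial is its constant term, and a nonzero constant is a
  unit.\<close>

lemma irrelevant_ideal_maximal:
  fixes J :: "'k::field mpoly set"
  assumes J: "ideal J (poly_ring m)" "irrelevant_ideal m \<subseteq> J" "1 \<notin> J"
  shows "J = irrelevant_ideal m"
proof
  show "J \<subseteq> irrelevant_ideal m"
  proof
    fix p assume p: "p \<in> J"
    have pR: "p \<in> carrier (poly_ring m)"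
      by (rule poly_ring_ideal_closed(5)[OF J(1) p])
    define c where "c = Poly_Mapping.lookup p 0"
    have const: "mconst d \<in> carrier (poly_ring m)" for d :: 'k
      unfolding mconst_def by (rule single_carrier) simp
    have "p - mconst c \<in> irrelevant_ideal m"
      using poly_ring_diff_closed[OF pR const[of c]]
      by (simp add: irrelevant_ideal_eq lookup_minus c_def mconst_def)
    then have "p - (p - mconst c) \<in> J"
      using J(2) p poly_ring_ideal_closed(3)[OF J(1)] by blast
    then have "mconst (inverse c) * mconst c \<in> J"
      using poly_ring_ideal_closed(4)[OF J(1) _ const] by simp
    with J(3) have "c = 0"
      by (cases "c = 0") (auto simp: mconst_def mult_single)
    with pR show "p \<in> irrelevant_ideal m"
      by (simp add: irrelevant_ideal_eq c_def)
  qed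
qed (rule J(2))

text \<open>The product \<open>x\<^sub>i p\<close> vanishes on the \<open>i\<close>-th axis because of \<open>p\<close> and on the others because of \<open>x\<^sub>i\<close>.
  Geometrically: an irreducible closed subset of the union of the axes on which \<open>x\<^sub>i\<close> does not vanish
  lies in the \<open>i\<close>-th axis.\<close>

lemma axis_kernel_subset_prime:
  fixes P :: "'k::field mpoly set"
  assumes P: "primeideal P (poly_ring m)" "axes_ideal m \<subseteq> P" and i: "i \<in> {1..m}" "mvar i \<notin> P"
    and p: "p \<in> carrier (poly_ring m)" "axis_res i p = 0"
  shows "p \<in> P"
proof -
  have "mvar i * p \<in> axes_ideal m"
    using p poly_ring_mult_closed[OF mvar_carrier[OF i(1)] p(1)]
    by (auto simp: axes_ideal_def axis_res_mult axis_res_mvar)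
  with P(2) i p(1) show ?thesis
    using primeideal_poly_ringD(3)[OF P(1) mvar_carrier[OF i(1)] p(1)] by blast
qed

text \<open>If \<open>P\<^sub>0\<close> contained all variables, it would be maximal. So it misses some \<open>x\<^sub>i\<close>, and then all three
  primes contain the kernel of the restriction to the \<open>i\<close>-th axis. The image of \<open>P\<^sub>1\<close> in \<open>k[x\<^sub>i]\<close> is a
  nonzero prime, hence maximal, and cannot be strictly contained in the image of \<open>P\<^sub>2\<close>.\<close>

lemma no_prime_chain_axes:
  fixes P\<^sub>0 P\<^sub>1 P\<^sub>2 :: "'k::field mpoly set"
  assumes prime: "primeideal P\<^sub>0 (poly_ring m)" "primeideal P\<^sub>1 (poly_ring m)" "primeideal P\<^sub>2 (poly_ring m)"
    and axes: "axes_ideal m \<subseteq> P\<^sub>0" and chain: "P\<^sub>0 \<subset> P\<^sub>1" "P\<^sub>1 \<subset> P\<^sub>2"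
  shows False
proof -
  interpret R: cring "poly_ring m :: 'k mpoly ring" by (rule cring_poly_ring)
  note ideal = prime[THEN primeideal_poly_ringD(1)]
  have "\<exists>i\<in>{1..m}. mvar i \<notin> P\<^sub>0"
  proof (rule ccontr)
    assume "\<not> (\<exists>i\<in>{1..m}. mvar i \<notin> P\<^sub>0)"
    then have "irrelevant_ideal m \<subseteq> P\<^sub>0"
      unfolding irrelevant_ideal_def by (intro R.genideal_minimal ideal) auto
    then have "P\<^sub>0 = irrelevant_ideal m" "P\<^sub>1 = irrelevant_ideal m"
      using chain ideal prime[THEN primeideal_poly_ringD(2)]
      by (intro irrelevant_ideal_maximal; blast)+
    with chain show False by blast
  qed
  then obtain i where i: "i \<in> {1..m}" "mvar i \<notin> P\<^sub>0" by blast
  have kernel: "p \<in> P\<^sub>0" if "p \<in> carrier (poly_ring m)" "axis_res i p = 0" for p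
    using axis_kernel_subset_prime[OF prime(1) axes i that] .
  have res_mem: "axis_res i p \<in> axis_res i ` P \<longleftrightarrow> p \<in> P"
    if P: "ideal P (poly_ring m)" "P\<^sub>0 \<subseteq> P" and p: "p \<in> carrier (poly_ring m)" for p P
  proof
    assume "axis_res i p \<in> axis_res i ` P"
    then obtain q where q: "q \<in> P" "axis_res i p = axis_res i q" by blast
    then have "p - q \<in> P\<^sub>0"
      using p poly_ring_ideal_closed(5)[OF P(1) q(1)]
      by (intro kernel poly_ring_diff_closed) (auto simp: axis_res_diff)
    then have "(p - q) + q \<in> P"
      using poly_ring_ideal_closed(2)[OF P(1)] P(2) q(1) by blast
    then show "p \<in> P" by simp
  qed blast
  have surj: "\<exists>p\<in>carrier (poly_ring m). f = axis_res i p" for f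
    using axis_poly_carrier[OF i(1), of f] axis_res_axis_poly_same[of i f] by metis
  have diff: "f - g \<in> axis_res i ` P" if "ideal P (poly_ring m)" "f \<in> axis_res i ` P" "g \<in> axis_res i ` P"
    for P f g
    using that poly_ring_ideal_closed(3)[OF that(1)] by (auto simp flip: axis_res_diff)
  have mult: "g * f \<in> axis_res i ` P" if "ideal P (poly_ring m)" "f \<in> axis_res i ` P" for P f g
  proof -
    obtain p where "p \<in> carrier (poly_ring m)" "g = axis_res i p"
      using surj[of g] by blast
    with that poly_ring_ideal_closed(4)[OF that(1)] show ?thesis
      by (auto simp flip: axis_res_mult)
  qed
  have "axis_res i ` P\<^sub>1 = axis_res i ` P\<^sub>2"
  proof -
    obtain p where p: "p \<in> P\<^sub>1" "p \<notin> P\<^sub>0" using chain(1) by blast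
    show ?thesis
    proof (rule poly_nonzero_prime_maximal)
      show "axis_res i p \<in> axis_res i ` P\<^sub>1" using p(1) by blast
      show "axis_res i p \<noteq> 0"
        using kernel[of p] poly_ring_ideal_closed(5)[OF ideal(2) p(1)] p(2) by blast
      show "axis_res i ` P\<^sub>1 \<subseteq> axis_res i ` P\<^sub>2" using chain(2) by blast
      show "1 \<notin> axis_res i ` P\<^sub>2"
        using res_mem[OF ideal(3), of 1] chain primeideal_poly_ringD(2)[OF prime(3)] by simp
      show "f \<in> axis_res i ` P\<^sub>1 \<or> g \<in> axis_res i ` P\<^sub>1" if fg: "f * g \<in> axis_res i ` P\<^sub>1" for f g
      proof -
        obtain a b where a: "a \<in> carrier (poly_ring m)" "f = axis_res i a"
          and b: "b \<in> carrier (poly_ring m)" "g = axis_res i b"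
          using surj by metis
        have "a * b \<in> P\<^sub>1"
          using fg res_mem[OF ideal(2) _ poly_ring_mult_closed[OF a(1) b(1)]] chain a b
          by (auto simp: axis_res_mult)
        then show ?thesis
          using primeideal_poly_ringD(3)[OF prime(2) a(1) b(1)] a b by blast
      qed
      show "\<And>f g. f \<in> axis_res i ` P\<^sub>1 \<Longrightarrow> g \<in> axis_res i ` P\<^sub>1 \<Longrightarrow> f - g \<in> axis_res i ` P\<^sub>1"
        by (rule diff[OF ideal(2)])
      show "\<And>f g. f \<in> axis_res i ` P\<^sub>2 \<Longrightarrow> g \<in> axis_res i ` P\<^sub>2 \<Longrightarrow> f - g \<in> axis_res i ` P\<^sub>2"
        by (rule diff[OF ideal(3)])
      show "\<And>f g. f \<in> axis_res i ` P\<^sub>1 \<Longrightarrow> g * f \<in> axis_res i ` P\<^sub>1"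
        by (rule mult[OF ideal(2)])
      show "\<And>f g. f \<in> axis_res i ` P\<^sub>2 \<Longrightarrow> g * f \<in> axis_res i ` P\<^sub>2"
        by (rule mult[OF ideal(3)])
    qed
  qed
  moreover obtain q where q: "q \<in> P\<^sub>2" "q \<notin> P\<^sub>1" using chain(2) by blast
  ultimately have "axis_res i q \<in> axis_res i ` P\<^sub>1" by blast
  then show False
    using res_mem[OF ideal(2) _ poly_ring_ideal_closed(5)[OF ideal(3) q(1)]] chain(1) q(2) by blast
qed

lemma primeideal_axis_kernel:
  assumes "i \<in> {1..m}"
  shows "primeideal {p \<in> carrier (poly_ring m). axis_res i p = (0::'k::field poly)} (poly_ring m)"
    (is "primeideal ?P ?R")
proof (rule primeidealI)
  show "ideal ?P ?R"
  proof (rule poly_ring_idealI)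
    show "p + q \<in> ?P" if "p \<in> ?P" "q \<in> ?P" for p q
      using that poly_ring_add_closed[of p m q] by (simp add: axis_res_add)
    show "q * p \<in> ?P" if "p \<in> ?P" "q \<in> carrier ?R" for p q
      using that poly_ring_mult_closed[of q m p] by (simp add: axis_res_mult)
  qed simp_all
  show "cring ?R" by (rule cring_poly_ring)
  have "1 \<in> carrier ?R" "1 \<notin> ?P" by simp_all
  then show "carrier ?R \<noteq> ?P" by blast
  show "a \<in> ?P \<or> b \<in> ?P" if "a \<in> carrier ?R" "b \<in> carrier ?R" "a \<otimes>\<^bsub>?R\<^esub> b \<in> ?P" for a b
    using that by (simp add: axis_res_mult)
qed

lemma primeideal_irrelevant_ideal:
  "primeideal (irrelevant_ideal m :: 'k::field mpoly set) (poly_ring m)"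
    (is "primeideal ?M ?R")
proof (rule primeidealI)
  show cring: "cring ?R" by (rule cring_poly_ring)
  show "ideal ?M ?R"
    unfolding irrelevant_ideal_def using mvar_carrier
    by (intro ring.genideal_ideal cring.axioms(1) cring) blast
  have "1 \<in> carrier ?R" "1 \<notin> ?M"
    by (simp_all add: irrelevant_ideal_eq lookup_one)
  then show "carrier ?R \<noteq> ?M" by blast
  show "a \<in> ?M \<or> b \<in> ?M" if "a \<in> carrier ?R" "b \<in> carrier ?R" "a \<otimes>\<^bsub>?R\<^esub> b \<in> ?M" for a b
    using that by (simp add: irrelevant_ideal_eq lookup_zero_mult)
qed

text \<open>The lower bound comes from the chain of the ideal of the first axis and the ideal of the
  origin.\<close>

lemma krull_dim_axes:
  assumes "m \<ge> 1"
  shows "krull_dim (poly_ring m Quot (axes_ideal m :: 'k::field mpoly set)) = 1"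
proof -
  let ?R = "poly_ring m :: 'k mpoly ring" and ?I = "axes_ideal m :: 'k mpoly set"
  let ?C = "{Ps. Ps \<noteq> [] \<and> (\<forall>P\<in>set Ps. primeideal P ?R \<and> ?I \<subseteq> P) \<and> sorted_wrt (\<subset>) Ps}"
  interpret R: cring ?R by (rule cring_poly_ring)
  let ?P = "{p \<in> carrier ?R. axis_res 1 p = 0}"
  have P: "primeideal ?P ?R"
    using assms by (intro primeideal_axis_kernel) simp
  have M: "primeideal (irrelevant_ideal m) ?R"
    by (rule primeideal_irrelevant_ideal)
  have IP: "?I \<subseteq> ?P"
    using assms by (auto simp: axes_ideal_def)
  have PM: "?P \<subset> irrelevant_ideal m"
  proof
    show "?P \<subseteq> irrelevant_ideal m"
    proof
      fix p assume p: "p \<in> ?P"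
      then have "Poly_Mapping.lookup p 0 = 0"
        using coeff_0_axis_res[of 1 p] by simp
      with p show "p \<in> irrelevant_ideal m"
        by (simp add: irrelevant_ideal_eq)
    qed
    have "mvar 1 \<in> (irrelevant_ideal m :: 'k mpoly set)" "mvar 1 \<notin> ?P"
      using assms mvar_carrier[of 1 m]
      by (auto simp: irrelevant_ideal_eq lookup_mvar_zero axis_res_mvar)
    then show "?P \<noteq> irrelevant_ideal m" by blast
  qed
  have "[?P, irrelevant_ideal m] \<in> ?C"
    using P M IP PM by auto
  then have "1 \<le> (SUP Ps\<in>?C. enat (length Ps - 1))"
    by (rule SUP_upper2) (simp add: one_enat_def)
  moreover have "(SUP Ps\<in>?C. enat (length Ps - 1)) \<le> 1"
  proof (rule SUP_least)
    fix Ps assume Ps: "Ps \<in> ?C"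
    have "length Ps < 3"
    proof (rule ccontr)
      assume "\<not> length Ps < 3"
      then have "Ps ! k \<in> set Ps" if "k < 3" for k
        using that by simp
      moreover have "Ps ! 0 \<subset> Ps ! 1" "Ps ! 1 \<subset> Ps ! 2"
        using Ps \<open>\<not> length Ps < 3\<close> by (auto simp: sorted_wrt_iff_nth_less)
      ultimately show False
        using Ps no_prime_chain_axes[of "Ps ! 0" m "Ps ! 1" "Ps ! 2"] by auto
    qed
    then show "enat (length Ps - 1) \<le> 1"
      by (simp add: one_enat_def)
  qed
  ultimately show ?thesis
    unfolding R.krull_dim_quotient[OF ideal_axes_ideal] by (intro antisym)
qed

section \<open>The union of the axes has depth one\<close>

lemma coset_eq_iff:
  assumes "p \<in> carrier (poly_ring m)" "q \<in> carrier (poly_ring m)"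
  shows "axes_ideal m +>\<^bsub>poly_ring m\<^esub> p = axes_ideal m +>\<^bsub>poly_ring m\<^esub> q \<longleftrightarrow>
    (\<forall>i\<in>{1..m}. axis_res i p = axis_res i (q :: 'k::field mpoly))"
proof -
  interpret cring "poly_ring m :: 'k mpoly ring" by (rule cring_poly_ring)
  show ?thesis
    using quotient_eq_iff_same_a_r_cos[OF ideal_axes_ideal assms]
    by (simp add: a_minus_poly_ring assms axes_ideal_def poly_ring_diff_closed axis_res_diff)
qed

lemma coset_mult:
  fixes p q :: "'k::field mpoly"
  assumes "p \<in> carrier (poly_ring m)" "q \<in> carrier (poly_ring m)"
  shows "(axes_ideal m +>\<^bsub>poly_ring m\<^esub> p) \<otimes>\<^bsub>poly_ring m Quot axes_ideal m\<^esub> (axes_ideal m +>\<^bsub>poly_ring m\<^esub> q) =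
    axes_ideal m +>\<^bsub>poly_ring m\<^esub> (p * q)"
  using ideal.rcoset_mult_add[OF ideal_axes_ideal assms] by (simp add: FactRing_def)

text \<open>Principal ideals of the quotient, expressed by restrictions to the axes. The same \<open>c\<close> has to work on
  all axes, so membership is not a condition on each axis separately.\<close>

lemma coset_mem_principal_iff:
  fixes p a :: "'k::field mpoly"
  assumes p: "p \<in> carrier (poly_ring m)" and a: "a \<in> carrier (poly_ring m)"
  shows "axes_ideal m +>\<^bsub>poly_ring m\<^esub> p \<in>
      genideal (poly_ring m Quot axes_ideal m) {axes_ideal m +>\<^bsub>poly_ring m\<^esub> a} \<longleftrightarrow>
    (\<exists>c\<in>carrier (poly_ring m). \<forall>i\<in>{1..m}. axis_res i p = axis_res i c * axis_res i a)"
proof -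
  let ?R = "poly_ring m :: 'k mpoly ring" and ?I = "axes_ideal m :: 'k mpoly set"
  let ?A = "?R Quot ?I"
  interpret A: cring ?A
    by (rule ideal.quotient_is_cring[OF ideal_axes_ideal cring_poly_ring])
  have carrier: "carrier ?A = (\<lambda>f. ?I +>\<^bsub>?R\<^esub> f) ` carrier ?R"
    by (auto simp: FactRing_def A_RCOSETS_def')
  then have "?I +>\<^bsub>?R\<^esub> a \<in> carrier ?A"
    using a by blast
  then have "genideal ?A {?I +>\<^bsub>?R\<^esub> a} = {x \<otimes>\<^bsub>?A\<^esub> (?I +>\<^bsub>?R\<^esub> a) | x. x \<in> carrier ?A}"
    using A.cgenideal_eq_genideal[of "?I +>\<^bsub>?R\<^esub> a"] by (simp add: cgenideal_def)
  also have "\<dots> = {?I +>\<^bsub>?R\<^esub> (c * a) | c. c \<in> carrier ?R}"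
    unfolding carrier using coset_mult[OF _ a] by blast
  finally have "?I +>\<^bsub>?R\<^esub> p \<in> genideal ?A {?I +>\<^bsub>?R\<^esub> a} \<longleftrightarrow>
      (\<exists>c\<in>carrier ?R. ?I +>\<^bsub>?R\<^esub> p = ?I +>\<^bsub>?R\<^esub> (c * a))"
    by blast
  then show ?thesis
    by (simp add: coset_eq_iff[OF p poly_ring_mult_closed[OF _ a]] axis_res_mult)
qed

lemma coset_mem_zero_iff:
  fixes p :: "'k::field mpoly"
  assumes p: "p \<in> carrier (poly_ring m)"
  shows "axes_ideal m +>\<^bsub>poly_ring m\<^esub> p \<in> genideal (poly_ring m Quot axes_ideal m) {} \<longleftrightarrow>
    (\<forall>i\<in>{1..m}. axis_res i p = 0)"
proof -
  let ?R = "poly_ring m :: 'k mpoly ring" and ?I = "axes_ideal m :: 'k mpoly set"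
  let ?A = "?R Quot ?I"
  interpret R: cring ?R by (rule cring_poly_ring)
  interpret A: cring ?A
    by (rule ideal.quotient_is_cring[OF ideal_axes_ideal cring_poly_ring])
  have "genideal ?A {} \<subseteq> {\<zero>\<^bsub>?A\<^esub>}"
    by (rule A.genideal_minimal[OF A.zeroideal]) simp
  moreover have "\<zero>\<^bsub>?A\<^esub> \<in> genideal ?A {}"
    by (intro additive_subgroup.zero_closed ideal.axioms(1) A.genideal_ideal) simp
  moreover have "\<zero>\<^bsub>?A\<^esub> = ?I +>\<^bsub>?R\<^esub> 0"
    using R.a_coset_add_zero[of ?I] poly_ring_ideal_closed(5)[OF ideal_axes_ideal]
    by (auto simp: FactRing_def)
  ultimately show ?thesis
    using coset_eq_iff[OF p zero_carrier] by auto
qed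

text \<open>Two axes are needed: the argument against a second member of a regular sequence compares the
  constant terms of a multiplier on the first and on the second axis.\<close>

lemma depth_axes:
  assumes "m \<ge> 2"
  shows "depth (poly_ring m Quot axes_ideal m)
    ((\<lambda>f. axes_ideal m +>\<^bsub>poly_ring m\<^esub> f) ` (irrelevant_ideal m :: 'k::field mpoly set)) = 1"
proof -
  let ?R = "poly_ring m :: 'k mpoly ring" and ?I = "axes_ideal m :: 'k mpoly set"
  let ?A = "?R Quot ?I" and ?q = "\<lambda>f. axes_ideal m +>\<^bsub>poly_ring m\<^esub> (f :: 'k mpoly)"
  let ?M = "?q ` irrelevant_ideal m"
  have carrier: "carrier ?A = ?q ` carrier ?R"
    by (auto simp: FactRing_def A_RCOSETS_def')
  have irr: "f \<in> irrelevant_ideal m \<longleftrightarrow> f \<in> carrier ?R \<and> Poly_Mapping.lookup f 0 = 0" for f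
    by (auto simp: irrelevant_ideal_eq)
  define s :: "'k mpoly" where "s = (\<Sum>i\<in>{1..m}. mvar i)"
  have s: "s \<in> carrier ?R" "s \<in> irrelevant_ideal m"
    using poly_ring_sum_closed[of "{1..m}" mvar m] mvar_carrier
    by (auto simp: s_def irr lookup_sum lookup_mvar_zero)
  have res_s: "axis_res i s = monom 1 1" if "i \<in> {1..m}" for i
    using that by (simp add: s_def axis_res_sum axis_res_mvar)
  have "regular_sequence ?A [?q s]"
    unfolding regular_sequence_def
  proof (intro conjI allI impI ballI)
    show "set [?q s] \<subseteq> carrier ?A"
      using s(1) carrier by auto
    fix k b assume "k < length [?q s]" "b \<in> carrier ?A"
      and mem: "[?q s] ! k \<otimes>\<^bsub>?A\<^esub> b \<in> genideal ?A (set (take k [?q s]))"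
    then obtain f where k: "k = 0" and f: "f \<in> carrier ?R" "b = ?q f"
      using carrier by auto
    have "?q (s * f) \<in> genideal ?A {}"
      using mem k f coset_mult[OF s(1) f(1)] by simp
    then have "axis_res i f = 0" if "i \<in> {1..m}" for i
      using coset_mem_zero_iff[OF poly_ring_mult_closed[OF s(1) f(1)]] that
      by (auto simp: axis_res_mult res_s)
    then show "b \<in> genideal ?A (set (take k [?q s]))"
      using coset_mem_zero_iff[OF f(1)] k f(2) by simp
  next
    have "?q 1 \<notin> genideal ?A {?q s}"
    proof
      assume "?q 1 \<in> genideal ?A {?q s}"
      then obtain c where "\<forall>i\<in>{1..m}. axis_res i 1 = axis_res i c * axis_res i s"
        using coset_mem_principal_iff[OF one_carrier s(1)] by blast
      then have "axis_res 1 1 = axis_res 1 c * axis_res 1 s"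
        using assms by (intro bspec[of _ _ 1]) auto
      then have "1 = axis_res 1 c * monom 1 1"
        using assms res_s[of 1] by simp
      then have "coeff 1 0 = coeff (axis_res 1 c * monom 1 1) 0" by simp
      then show False by (simp add: coeff_mult_0)
    qed
    moreover have "?q 1 \<in> carrier ?A"
      using carrier one_carrier by blast
    ultimately show "genideal ?A (set [?q s]) \<noteq> carrier ?A" by auto
  qed
  moreover have "set [?q s] \<subseteq> ?M"
    using s(2) by simp
  ultimately have "[?q s] \<in> {as. set as \<subseteq> ?M \<and> regular_sequence ?A as}"
    by blast
  then have "1 \<le> depth ?A ?M"
    unfolding depth_def by (rule SUP_upper2) (simp add: one_enat_def)
  moreover have "depth ?A ?M \<le> 1"
    unfolding depth_def
  proof (rule SUP_least)
    fix as assume "as \<in> {as. set as \<subseteq> ?M \<and> regular_sequence ?A as}"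
    then have M: "set as \<subseteq> ?M" and reg: "regular_sequence ?A as" by auto
    have "length as < 2"
    proof (rule ccontr)
      assume "\<not> length as < 2"
      then have len: "0 < length as" "1 < length as" by auto
      have regular: "b \<in> genideal ?A (set (take k as))"
        if "k < length as" "b \<in> carrier ?A" "as ! k \<otimes>\<^bsub>?A\<^esub> b \<in> genideal ?A (set (take k as))" for k b
        using reg that unfolding regular_sequence_def by blast
      have "as ! 0 \<in> ?M" "as ! 1 \<in> ?M"
        using M len by (auto simp: subset_iff)
      then obtain f g where f: "f \<in> carrier ?R" "Poly_Mapping.lookup f 0 = 0" "as ! 0 = ?q f"
        and g: "g \<in> carrier ?R" "Poly_Mapping.lookup g 0 = 0" "as ! 1 = ?q g"
        by (auto simp: irr)
      have take1: "set (take 1 as) = {?q f}"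
        using len f(3) by (cases as) auto
      \<comment> \<open>If \<open>f\<close> vanished on the \<open>i\<close>-th axis, then \<open>x\<^sub>i\<close> would be a nonzero element annihilated by \<open>f\<close>.\<close>
      have nonzero: "axis_res i f \<noteq> 0" if i: "i \<in> {1..m}" for i
      proof
        assume zero: "axis_res i f = 0"
        have xi: "mvar i \<in> carrier ?R" by (rule mvar_carrier[OF i])
        have "?q (f * mvar i) \<in> genideal ?A {}"
          using zero by (simp add: coset_mem_zero_iff poly_ring_mult_closed f(1) xi axis_res_mult axis_res_mvar)
        then have "?q (mvar i) \<in> genideal ?A {}"
          using regular[OF len(1), of "?q (mvar i)"] coset_mult[OF f(1) xi] f(3) carrier xi by simp
        then have "axis_res i (mvar i) = (0 :: 'k poly)"
          using i coset_mem_zero_iff[OF xi] by blast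
        then show False
          by (simp add: axis_res_mvar monom_eq_0_iff)
      qed
      \<comment> \<open>\<open>b\<close> represents a socle element of \<open>A / (f)\<close>: \<open>f\<close> on the first axis and \<open>0\<close> on the others. Both
          functions fit together at the origin because \<open>f\<close> has no constant term.\<close>
      define b where "b = axis_poly 1 (axis_res 1 f)"
      have one: "1 \<in> {1..m}" and two: "2 \<in> {1..m}" using assms by auto
      have b: "b \<in> carrier ?R"
        unfolding b_def by (rule axis_poly_carrier[OF one])
      have res_b: "axis_res i b = (if i = 1 then axis_res 1 f else 0)" for i
        by (simp add: b_def axis_res_axis_poly_same axis_res_axis_poly_other coeff_0_axis_res f(2))
      \<comment> \<open>The multiplier that shows \<open>g b \<in> (f)\<close>: \<open>g\<close> on the first axis and \<open>0\<close> on the others.\<close>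
      define c where "c = axis_poly 1 (axis_res 1 g)"
      have c: "c \<in> carrier ?R"
        unfolding c_def by (rule axis_poly_carrier[OF one])
      have res_c: "axis_res i c = (if i = 1 then axis_res 1 g else 0)" for i
        by (simp add: c_def axis_res_axis_poly_same axis_res_axis_poly_other coeff_0_axis_res g(2))
      have "?q (g * b) \<in> genideal ?A {?q f}"
        unfolding coset_mem_principal_iff[OF poly_ring_mult_closed[OF g(1) b] f(1)]
        using c by (intro bexI[of _ c]) (auto simp: axis_res_mult res_b res_c)
      then have "?q b \<in> genideal ?A {?q f}"
        using regular[OF len(2), of "?q b"] take1 coset_mult[OF g(1) b] g(3) carrier b by simp
      then obtain d where d: "\<And>i. i \<in> {1..m} \<Longrightarrow> axis_res i b = axis_res i d * axis_res i f"
        using coset_mem_principal_iff[OF b f(1)] by blast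
      \<comment> \<open>A multiplier \<open>d\<close> with \<open>b = d f\<close> would be \<open>1\<close> on the first axis and \<open>0\<close> on the second, with
          different values at the origin.\<close>
      have "axis_res 2 d = 0"
        using d[OF two] nonzero[OF two] by (simp add: res_b)
      moreover have "axis_res 1 d = 1"
        using d[OF one] nonzero[OF one] by (simp add: res_b)
      ultimately show False
        using coeff_0_axis_res[of 1 d] coeff_0_axis_res[of 2 d] by simp
    qed
    then show "enat (length as) \<le> 1"
      by (simp add: one_enat_def)
  qed
  ultimately show ?thesis by (intro antisym)
qed

theorem theorem3p14:
  fixes n r :: nat
  assumes "n \<ge> 3" and "r \<ge> n - 3"
  shows "cohen_macaulay_ideal (n + r)
    (Inc_ideal n (n + r) (edge_ideal n (cycle_edges n) :: 'k::field mpoly set))"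
  unfolding Inc_ideal_cycle[OF assms] cohen_macaulay_ideal_def
  using assms by (simp add: ideal_axes_ideal depth_axes krull_dim_axes)

end
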